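(* Fix $\varepsilon>0$ and $\delta\in(0,1/2)$. There is a one-sided adaptive algorithm which, given $n$, $\varepsilon$ (and $\delta$) and access to the oracles $\mathrm{MQ}(f)$ and $\mathrm{Samp}(f)$ for an unknown $f:\{0,1\}^n\to\{0,1\}$ (the algorithm is not given $N:=|f^{-1}(1)|$), is an $\varepsilon$-relative-error tester for monotonicity: it always outputs "monotone" when $f$ is monotone, and outputs "not monotone" with probability at least $2/3$ when $f$ has relative distance at least $\varepsilon$ from the class of monotone functions. Moreover, with probability at least $1-\delta$, it makes no more than $O(\log(1/\delta)/\varepsilon+\log(N)/\varepsilon)$ calls in total to $\mathrm{Samp}(f)$ and $\mathrm{MQ}(f)$.
   Context: For $f,g:\{0,1\}^n\to\{0,1\}$, the relative distance from $f$ to $g$ is $\mathrm{rel\text{-}dist}(f,g)=|f^{-1}(1)\,\triangle\, g^{-1}(1)|/|f^{-1}(1)|$, and for a class $\mathcal C$, $\mathrm{rel\text{-}dist}(f,\mathcal C)=\min_{g\in\mathcal C}\mathrm{rel\text{-}dist}(f,g)$. The oracle $\mathrm{MQ}(f)$ (black-box / membership query oracle) takes $x\in\{0,1\}^n$ and returns $f(x)$. The oracle $\mathrm{Samp}(f)$ takes no input and returns an independent uniformly random element of $f^{-1}(1)$ (if $f$ is identically $0$ it returns a special symbol $\bot$). A function $f$ is monotone if $x\preceq y$ coordinatewise implies $f(x)\le f(y)$. A one-sided tester accepts every function in the class with probability $1$. *)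

theory Defs
  imports "HOL-Probability.Probability"
begin

type_synonym point = "bool list"

definition cube :: "nat \<Rightarrow> point set" where
  "cube n = {x. length x = n}"

text \<open>
  A Boolean function on the \<open>n\<close>-cube is a total function \<open>f :: point \<Rightarrow> bool\<close> of which only the
  values on \<open>cube n\<close> matter. Everything below except the answers to membership queries depends
  on \<open>f\<close> only through its restriction to \<open>cube n\<close>. A query outside the cube is answered by an
  arbitrary extension of the function, so a statement about all \<open>f\<close> leaves no use for it.
\<close>

definition ones :: "nat \<Rightarrow> (point \<Rightarrow> bool) \<Rightarrow> point set" where
  "ones n f = {x \<in> cube n. f x}"

definition monotone_functions :: "nat \<Rightarrow> (point \<Rightarrow> bool) set" where
  "monotone_functions n = {f. monotone_on (cube n) (list_all2 (\<le>)) (\<le>) f}"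

text \<open>
  If \<open>f\<close> vanishes on the cube, the quotient is \<open>0\<close> because \<open>x / 0 = 0\<close>. The zero
  function is monotone, so this agrees with its distance from the monotone functions being \<open>0\<close>.
\<close>

definition rel_dist :: "nat \<Rightarrow> (point \<Rightarrow> bool) \<Rightarrow> (point \<Rightarrow> bool) \<Rightarrow> real" where
  "rel_dist n f g = real (card (sym_diff (ones n f) (ones n g))) / real (card (ones n f))"

text \<open>
  The set of distances is finite, since \<open>rel_dist n f g\<close> depends only on the values of \<open>g\<close> on
  \<open>cube n\<close>. Hence \<open>Min\<close> is a true minimum for every nonempty class.
\<close>

definition rel_dist_class :: "nat \<Rightarrow> (point \<Rightarrow> bool) \<Rightarrow> (point \<Rightarrow> bool) set \<Rightarrow> real" where
  "rel_dist_class n f \<C> = Min (rel_dist n f ` \<C>)"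

datatype verdict = Accept | Reject

text \<open>
  A randomized adaptive oracle algorithm is a well-founded (always halting) decision tree. A node
  outputs a verdict, queries \<open>MQ(f)\<close> at a point, calls \<open>Samp(f)\<close> (where \<open>None\<close> is the
  special symbol returned for the zero function), or draws from a discrete distribution using its
  internal randomness, and continues depending on the answer.
\<close>

datatype algorithm =
    Output verdict
  | MQ point "bool \<Rightarrow> algorithm"
  | Samp "point option \<Rightarrow> algorithm"
  | Rand "nat pmf" "nat \<Rightarrow> algorithm"

definition samp :: "nat \<Rightarrow> (point \<Rightarrow> bool) \<Rightarrow> point option pmf" where
  "samp n f = (if ones n f = {} then return_pmf None else map_pmf Some (pmf_of_set (ones n f)))"

text \<open>
  The joint distribution of the verdict and the total number of oracle calls. Internal randomness
  is free.
\<close>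

primrec run :: "nat \<Rightarrow> (point \<Rightarrow> bool) \<Rightarrow> algorithm \<Rightarrow> (verdict \<times> nat) pmf" where
  "run n f (Output v) = return_pmf (v, 0)"
| "run n f (MQ x k) = map_pmf (apsnd Suc) (run n f (k (f x)))"
| "run n f (Samp k) = bind_pmf (samp n f) (\<lambda>s. map_pmf (apsnd Suc) (run n f (k s)))"
| "run n f (Rand p k) = bind_pmf p (\<lambda>i. run n f (k i))"

definition one_sided_rel_error_tester ::
    "nat \<Rightarrow> real \<Rightarrow> (point \<Rightarrow> bool) set \<Rightarrow> algorithm \<Rightarrow> bool" where
  "one_sided_rel_error_tester n \<epsilon> \<C> T \<longleftrightarrow>
     (\<forall>f \<in> \<C>. measure_pmf.prob (run n f T) {r. fst r = Accept} = 1) \<and>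
     (\<forall>f. rel_dist_class n f \<C> \<ge> \<epsilon> \<longrightarrow> measure_pmf.prob (run n f T) {r. fst r = Reject} \<ge> 2 / 3)"

end

theory Submission imports Defs
begin

text \<open>
  Draw about \<open>6 / \<epsilon>\<close> samples and keep a sample \<open>x\<close> with the largest number \<open>m\<close> of zero coordinates.
  Query a uniformly random point above \<open>x\<close> and reject if it is not a one. Then repeat about
  \<open>12 m / \<epsilon>\<close> times: draw a sample, query a random upper neighbour, and reject if it is not a one.

  Complexity: there are \<open>2 ^ m\<close> points above \<open>x\<close> but only \<open>N\<close> ones, so the random point above \<open>x\<close>
  leads to rejection except with probability \<open>N / 2 ^ m\<close>. Hence the long second phase is
  entered with \<open>m > log 2 N + log 2 (1 / \<delta>)\<close> only with probability at most \<open>\<delta>\<close>.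

  Soundness: let \<open>q\<close> be least such that at most \<open>\<epsilon> N / 2\<close> ones have more than \<open>q\<close> zeros, so that
  the first phase probably gives \<open>m \<ge> q\<close>. Erasing these ones leaves a function at
  distance at least \<open>\<epsilon> N / 2\<close> from monotone, and coordinatewise sorting shows that it has at least
  \<open>\<epsilon> N / 4\<close> violated edges. These are violated by \<open>f\<close> as well and start at points with at most \<open>q\<close>
  upper neighbours, so each trial of the second phase finds one with probability at least
  \<open>\<epsilon> / (4 q)\<close>.
\<close>

section \<open>The upper shadow of a point\<close>

abbreviation zeros :: "point \<Rightarrow> nat" where
  "zeros x \<equiv> count_list x False"

text \<open>A list rather than a set, so that a uniform index drawn by \<open>Rand\<close> picks a
  uniform neighbour.\<close>

primrec up_neighbours :: "point \<Rightarrow> point list" where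
  "up_neighbours [] = []"
| "up_neighbours (b # x) =
     (if b then [] else [True # x]) @ map (Cons b) (up_neighbours x)"

primrec up_set :: "point \<Rightarrow> point list" where
  "up_set [] = [[]]"
| "up_set (b # x) = (if b then [] else map (Cons False) (up_set x)) @ map (Cons True) (up_set x)"

lemma length_up_neighbours [simp]: "length (up_neighbours x) = zeros x"
  by (induction x) auto

lemma length_up_set [simp]: "length (up_set x) = 2 ^ zeros x"
  by (induction x) auto

lemma distinct_up_set: "distinct (up_set x)"
  by (induction x) (auto simp: distinct_map)

lemma up_neighbours_above:
  "y \<in> set (up_neighbours x) \<Longrightarrow> list_all2 (\<le>) x y \<and> length y = length x \<and> zeros y < zeros x"
  by (induction x arbitrary: y) (auto simp: list_all2_refl split: if_splits)

lemma up_set_above: "y \<in> set (up_set x) \<Longrightarrow> list_all2 (\<le>) x y \<and> length y = length x"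
  by (induction x arbitrary: y) (auto split: if_splits)

lemma finite_cube [simp]: "finite (cube n)"
  using finite_lists_length_eq[of "UNIV :: bool set" n] by (simp add: cube_def)

lemma finite_ones [simp]: "finite (ones n f)"
  by (simp add: ones_def)

lemma cube_0 [simp]: "cube 0 = {[]}"
  by (auto simp: cube_def)

lemma sum_cube_Suc:
  fixes g :: "point \<Rightarrow> 'a :: comm_monoid_add"
  shows "sum g (cube (Suc n)) = (\<Sum>x\<in>cube n. g (False # x) + g (True # x))"
proof -
  have "cube (Suc n) = Cons False ` cube n \<union> Cons True ` cube n"
    by (auto simp: cube_def length_Suc_conv image_iff)
  then have "sum g (cube (Suc n)) = sum g (Cons False ` cube n) + sum g (Cons True ` cube n)"
    by (simp only:) (rule sum.union_disjoint; auto)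
  also have "\<dots> = (\<Sum>x\<in>cube n. g (False # x)) + (\<Sum>x\<in>cube n. g (True # x))"
    by (simp add: sum.reindex)
  finally show ?thesis by (simp add: sum.distrib)
qed

section \<open>Violated edges and the distance to monotonicity\<close>

definition violations :: "(point \<Rightarrow> bool) \<Rightarrow> point \<Rightarrow> nat" where
  "violations f x = length (filter (\<lambda>y. \<not> f y) (up_neighbours x))"

definition violated_edges :: "nat \<Rightarrow> (point \<Rightarrow> bool) \<Rightarrow> nat" where
  "violated_edges n f = (\<Sum>x\<in>cube n. of_bool (f x) * violations f x)"

definition hamming :: "nat \<Rightarrow> (point \<Rightarrow> bool) \<Rightarrow> (point \<Rightarrow> bool) \<Rightarrow> nat" where
  "hamming n f g = (\<Sum>x\<in>cube n. of_bool (f x \<noteq> g x))"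

text \<open>One-sided Hamming distance. For the two halves of a function along a coordinate it
  counts the violated edges in that direction.\<close>

definition excess :: "nat \<Rightarrow> (point \<Rightarrow> bool) \<Rightarrow> (point \<Rightarrow> bool) \<Rightarrow> nat" where
  "excess n f g = (\<Sum>x\<in>cube n. of_bool (f x \<and> \<not> g x))"

text \<open>Sorts along every coordinate direction in turn, starting with the last one.\<close>

primrec monotonize :: "nat \<Rightarrow> (point \<Rightarrow> bool) \<Rightarrow> point \<Rightarrow> bool" where
  "monotonize 0 f x = f x"
| "monotonize (Suc n) f x =
    (let a = monotonize n (\<lambda>y. f (False # y)) (tl x); b = monotonize n (\<lambda>y. f (True # y)) (tl x)
     in if hd x then a \<or> b else a \<and> b)"

text \<open>Each half is monotone by induction, and so are their conjunction and disjunction; the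
  former lies below the latter, which settles pairs that differ in the first coordinate.\<close>

lemma monotonize_mono:
  "length x = n \<Longrightarrow> list_all2 (\<le>) x y \<Longrightarrow> monotonize n f x \<Longrightarrow> monotonize n f y"
proof (induction n arbitrary: x y f)
  case 0
  then show ?case by simp
next
  case (Suc n)
  then obtain a x' where x: "x = a # x'" "length x' = n"
    by (metis length_Suc_conv)
  obtain b y' where y: "y = b # y'" "a \<le> b" "list_all2 (\<le>) x' y'"
    using Suc.prems(2) unfolding x(1) list_all2_Cons1 by blast
  have IH: "monotonize n (\<lambda>z. f (c # z)) x' \<longrightarrow> monotonize n (\<lambda>z. f (c # z)) y'" for c
    using Suc.IH[OF x(2) y(3)] by blast
  show ?case
    using Suc.prems(3) y(2) IH[of False] IH[of True]
    unfolding x(1) y(1) monotonize.simps Let_def list.sel by (cases a; cases b; simp; blast)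
qed

lemma monotonize_in_monotone_functions: "monotonize n f \<in> monotone_functions n"
  using monotonize_mono by (fastforce simp: monotone_functions_def monotone_on_def cube_def)

text \<open>Sorted pairs with k and l ones have excess max(0, k - l), the least possible for these
  numbers of ones, so sorting both functions along one direction cannot raise the excess.\<close>

lemma excess_monotonize_le: "excess n (monotonize n f) (monotonize n g) \<le> excess n f g"
proof (induction n arbitrary: f g)
  case 0
  then show ?case by (simp add: excess_def)
next
  case (Suc n)
  let ?f = "\<lambda>b x. f (b # x)" and ?g = "\<lambda>b x. g (b # x)"
  have "excess (Suc n) (monotonize (Suc n) f) (monotonize (Suc n) g)
      \<le> excess n (monotonize n (?f False)) (monotonize n (?g False))
        + excess n (monotonize n (?f True)) (monotonize n (?g True))"
    unfolding excess_def sum_cube_Suc sum.distrib[symmetric]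
    by (rule sum_mono) (auto simp: Let_def)
  also have "\<dots> \<le> excess n (?f False) (?g False) + excess n (?f True) (?g True)"
    by (intro add_mono Suc.IH)
  also have "\<dots> = excess (Suc n) f g"
    by (simp add: excess_def sum_cube_Suc sum.distrib)
  finally show ?case .
qed

lemma violated_edges_Suc:
  "violated_edges (Suc n) f = violated_edges n (\<lambda>x. f (False # x)) + violated_edges n (\<lambda>x. f (True # x))
     + excess n (\<lambda>x. f (False # x)) (\<lambda>x. f (True # x))"
  unfolding violated_edges_def excess_def sum_cube_Suc sum.distrib[symmetric]
  by (rule sum.cong) (auto simp: violations_def filter_map o_def)

text \<open>Sorting changes \<open>(c, d)\<close> only if it is inverted, and then flips both
  values.\<close>

lemma sort_two_bools_cost:
  "(of_bool (a \<noteq> (c \<and> d)) + of_bool (b \<noteq> (c \<or> d)) :: nat)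
    \<le> of_bool (a \<noteq> c) + of_bool (b \<noteq> d) + 2 * of_bool (c \<and> \<not> d)"
  by (cases a; cases b; cases c; cases d) simp_all

text \<open>The halves are sorted first, which by \<open>excess_monotonize_le\<close> creates no new
  inverted pairs in the first direction. The final sort flips two values per inverted pair, hence
  the factor 2.\<close>

lemma hamming_monotonize_le: "hamming n f (monotonize n f) \<le> 2 * violated_edges n f"
proof (induction n arbitrary: f)
  case 0
  then show ?case by (simp add: hamming_def)
next
  case (Suc n)
  let ?f = "\<lambda>b x. f (b # x)"
  let ?m = "\<lambda>b. monotonize n (?f b)"
  have "hamming (Suc n) f (monotonize (Suc n) f)
      \<le> hamming n (?f False) (?m False) + hamming n (?f True) (?m True)
        + 2 * excess n (?m False) (?m True)"
    unfolding hamming_def excess_def sum_cube_Suc sum_distrib_left sum.distrib[symmetric]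
      monotonize.simps Let_def list.sel if_True if_False
    by (rule sum_mono) (rule sort_two_bools_cost)
  also have "\<dots> \<le> 2 * violated_edges n (?f False) + 2 * violated_edges n (?f True)
        + 2 * excess n (?f False) (?f True)"
    by (intro add_mono Suc.IH mult_le_mono2 excess_monotonize_le)
  also have "\<dots> = 2 * violated_edges (Suc n) f"
    by (simp add: violated_edges_Suc)
  finally show ?case .
qed

lemma card_sym_diff_ones: "card (sym_diff (ones n f) (ones n g)) = hamming n f g"
proof -
  have "sym_diff (ones n f) (ones n g) = {x \<in> cube n. f x \<noteq> g x}"
    by (auto simp: ones_def)
  then show ?thesis
    by (simp add: hamming_def sum.If_cases of_bool_def Int_def)
qed

lemma hamming_triangle: "hamming n f h \<le> hamming n f g + hamming n g h"
  unfolding hamming_def sum.distrib[symmetric] by (rule sum_mono) auto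

text \<open>\<open>Min\<close> needs a finite set: the class may be infinite, but distances depend
  only on the subset of the cube where \<open>g\<close> holds.\<close>

lemma rel_dist_class_le:
  assumes "g \<in> \<C>"
  shows "rel_dist_class n f \<C> \<le> rel_dist n f g"
proof -
  have "rel_dist n f ` \<C> \<subseteq>
      (\<lambda>B. real (card (sym_diff (ones n f) B)) / real (card (ones n f))) ` Pow (cube n)"
    by (auto simp: rel_dist_def ones_def)
  then have "finite (rel_dist n f ` \<C>)"
    by (rule finite_subset) simp
  with assms show ?thesis
    by (simp add: rel_dist_class_def)
qed

lemma rel_dist_monotone_functions_le_1: "rel_dist_class n f (monotone_functions n) \<le> 1"
proof -
  have "(\<lambda>_. False) \<in> monotone_functions n"
    by (simp add: monotone_functions_def monotone_on_def)
  then have "rel_dist_class n f (monotone_functions n) \<le> rel_dist n f (\<lambda>_. False)"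
    by (rule rel_dist_class_le)
  also have "\<dots> \<le> 1"
    by (simp add: rel_dist_def ones_def)
  finally show ?thesis .
qed

text \<open>
  Erasing the points with more than \<open>q\<close> zeros creates no new violated edge below the threshold,
  because an upper neighbour has fewer zeros.
\<close>

lemma truncated_violations_ge:
  assumes far: "rel_dist_class n f (monotone_functions n) \<ge> \<epsilon>"
    and few: "real (card {x \<in> ones n f. zeros x > q}) \<le> \<epsilon> * card (ones n f) / 2"
  shows "(\<Sum>x | x \<in> ones n f \<and> zeros x \<le> q. real (violations f x)) \<ge> \<epsilon> * card (ones n f) / 4"
proof -
  define h where "h x = (f x \<and> zeros x \<le> q)" for x
  have "\<epsilon> \<le> rel_dist n f (monotonize n h)"
    using far rel_dist_class_le[OF monotonize_in_monotone_functions] by (rule order_trans)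
  then have "\<epsilon> * card (ones n f) \<le> hamming n f (monotonize n h)"
    by (cases "ones n f = {}") (auto simp: rel_dist_def card_sym_diff_ones field_simps card_gt_0_iff)
  also have "\<dots> \<le> hamming n f h + 2 * violated_edges n h"
    using hamming_triangle[of n f "monotonize n h" h] hamming_monotonize_le[of n h] by linarith
  also have "hamming n f h = card {x \<in> ones n f. zeros x > q}"
    unfolding card_sym_diff_ones[symmetric]
    by (rule arg_cong[of _ _ card]) (auto simp: ones_def h_def)
  also have "violated_edges n h = (\<Sum>x | x \<in> ones n f \<and> zeros x \<le> q. violations h x)"
    unfolding violated_edges_def
    by (rule sum.mono_neutral_cong_right) (auto simp: h_def ones_def)
  also have "\<dots> = (\<Sum>x | x \<in> ones n f \<and> zeros x \<le> q. violations f x)"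
  proof (rule sum.cong)
    fix x assume "x \<in> {x. x \<in> ones n f \<and> zeros x \<le> q}"
    then have "filter (\<lambda>y. \<not> h y) (up_neighbours x) = filter (\<lambda>y. \<not> f y) (up_neighbours x)"
      by (intro filter_cong) (auto simp: h_def dest: up_neighbours_above)
    then show "violations h x = violations f x" by (simp add: violations_def)
  qed simp
  finally show ?thesis using few by simp
qed

section \<open>The tester\<close>

text \<open>The all-ones point has no upper neighbour to draw, so its trial is skipped. The answer
  \<open>None\<close> reveals the zero function, which is monotone.\<close>

primrec edge_trials :: "nat \<Rightarrow> algorithm" where
  "edge_trials 0 = Output Accept"
| "edge_trials (Suc t) = Samp (\<lambda>s. case s of None \<Rightarrow> Output Accept | Some x \<Rightarrow>
     if zeros x = 0 then edge_trials t
     else Rand (pmf_of_set {..<zeros x}) (\<lambda>i. MQ (up_neighbours x ! i)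
       (\<lambda>b. if b then edge_trials t else Output Reject)))"

text \<open>The query in \<open>up_set x\<close> guards the cost. The factor 12 makes the expected
  number of detections at least 3 when a trial succeeds with probability at least \<epsilon> / (4 q)
  for some positive \<open>q\<close> up to \<open>zeros x\<close>.\<close>

definition check_depth :: "real \<Rightarrow> point \<Rightarrow> algorithm" where
  "check_depth \<epsilon> x = Rand (pmf_of_set {..<2 ^ zeros x}) (\<lambda>i. MQ (up_set x ! i)
     (\<lambda>b. if b then edge_trials (nat \<lceil>12 * zeros x / \<epsilon>\<rceil>) else Output Reject))"

primrec explore :: "real \<Rightarrow> nat \<Rightarrow> point \<Rightarrow> algorithm" where
  "explore \<epsilon> 0 x = check_depth \<epsilon> x"
| "explore \<epsilon> (Suc s) x = Samp (\<lambda>r. case r of None \<Rightarrow> Output Accept | Some y \<Rightarrow>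
     explore \<epsilon> s (if zeros x < zeros y then y else x))"

text \<open>
  For \<open>\<epsilon> > 1\<close> no function is \<open>\<epsilon>\<close>-far from monotone, and the query bound may be below \<open>1\<close>.
\<close>

definition monotonicity_tester :: "real \<Rightarrow> algorithm" where
  "monotonicity_tester \<epsilon> = (if \<epsilon> > 1 then Output Accept else
     Samp (\<lambda>r. case r of None \<Rightarrow> Output Accept | Some x \<Rightarrow> explore \<epsilon> (nat \<lceil>6 / \<epsilon>\<rceil>) x))"

lemma set_pmf_samp:
  "set_pmf (samp n f) = (if ones n f = {} then {None} else Some ` ones n f)"
  by (simp add: samp_def)

section \<open>One-sidedness\<close>

definition always_accepts :: "nat \<Rightarrow> (point \<Rightarrow> bool) \<Rightarrow> algorithm \<Rightarrow> bool" where
  "always_accepts n f T \<longleftrightarrow> (\<forall>r \<in> set_pmf (run n f T). fst r = Accept)"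

lemma always_accepts_simps [simp]:
  "always_accepts n f (Output v) \<longleftrightarrow> v = Accept"
  "always_accepts n f (MQ x k) \<longleftrightarrow> always_accepts n f (k (f x))"
  "always_accepts n f (Samp k') \<longleftrightarrow> (\<forall>s \<in> set_pmf (samp n f). always_accepts n f (k' s))"
  "always_accepts n f (Rand p k'') \<longleftrightarrow> (\<forall>i \<in> set_pmf p. always_accepts n f (k'' i))"
  by (auto simp: always_accepts_def)

lemma monotone_functionsD:
  assumes "f \<in> monotone_functions n" "x \<in> ones n f" "list_all2 (\<le>) x y"
  shows "f y"
proof -
  have "length y = length x" using assms(3) by (simp add: list_all2_lengthD)
  with assms show ?thesis
    by (auto simp: monotone_functions_def monotone_on_def ones_def cube_def)
qed

lemma always_accepts_edge_trials:
  assumes "f \<in> monotone_functions n"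
  shows "always_accepts n f (edge_trials t)"
proof (induction t)
  case (Suc t)
  have "f (up_neighbours x ! i)" if "x \<in> ones n f" "i < zeros x" for x i
    using that monotone_functionsD[OF assms] up_neighbours_above by (metis length_up_neighbours nth_mem)
  with Suc show ?case
    by (auto simp: set_pmf_samp lessThan_empty_iff)
qed simp

lemma always_accepts_explore:
  assumes "f \<in> monotone_functions n" "x \<in> ones n f"
  shows "always_accepts n f (explore \<epsilon> s x)"
  using assms(2)
proof (induction s arbitrary: x)
  case 0
  have "f (up_set x ! i)" if "i < 2 ^ zeros x" for i
    using that 0 monotone_functionsD[OF assms(1)] up_set_above by (metis length_up_set nth_mem)
  with always_accepts_edge_trials[OF assms(1)] show ?case
    by (auto simp: check_depth_def lessThan_empty_iff)
qed (auto simp: set_pmf_samp)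

lemma monotonicity_tester_one_sided:
  assumes "f \<in> monotone_functions n"
  shows "measure_pmf.prob (run n f (monotonicity_tester \<epsilon>)) {r. fst r = Accept} = 1"
proof -
  have "always_accepts n f (monotonicity_tester \<epsilon>)"
    using always_accepts_explore[OF assms] by (auto simp: monotonicity_tester_def set_pmf_samp)
  then show ?thesis
    by (auto simp: measure_pmf.prob_eq_1 AE_measure_pmf_iff always_accepts_def)
qed

section \<open>Query complexity\<close>

lemma prob_bind_pmf:
  "measure_pmf.prob (bind_pmf p k) A = (\<integral>x. measure_pmf.prob (k x) A \<partial>measure_pmf p)"
  unfolding measure_pmf_bind
  by (subst measure_pmf.measure_bind[where N = "count_space UNIV"])
     (auto simp: measure_pmf_in_subprob_algebra)

lemma prob_bind_pmf_ge:
  assumes "\<And>x. x \<in> set_pmf p \<Longrightarrow> x \<in> B \<Longrightarrow> c \<le> measure_pmf.prob (k x) A" "0 \<le> c"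
  shows "c * measure_pmf.prob p B \<le> measure_pmf.prob (bind_pmf p k) A"
proof -
  have "c * measure_pmf.prob p B = (\<integral>x. c * indicator B x \<partial>measure_pmf p)" by simp
  also have "\<dots> \<le> (\<integral>x. measure_pmf.prob (k x) A \<partial>measure_pmf p)"
    using assms
    by (intro integral_mono_AE measure_pmf.integrable_const_bound[where B = 1])
       (auto simp: AE_measure_pmf_iff indicator_def intro: order_trans[OF _ measure_pmf.prob_le_1])
  finally show ?thesis by (simp add: prob_bind_pmf)
qed

lemma run_edge_trials_cost:
  "r \<in> set_pmf (run n f (edge_trials t)) \<Longrightarrow> snd r \<le> 2 * t"
proof (induction t arbitrary: r)
  case (Suc t)
  from Suc.prems show ?case
    by (auto simp: set_pmf_samp lessThan_empty_iff split: if_splits dest!: Suc.IH)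
qed simp

text \<open>This covers the zero function, since \<open>log 2 0 = 0\<close> by convention.\<close>

lemma log_of_nat_nonneg: "0 \<le> log 2 (real m)"
  by (cases "m = 0") (simp_all add: log_def)

text \<open>
  Fewer than a \<open>\<delta>\<close> fraction of the points above \<open>x\<close> are ones when \<open>x\<close> has more than
  \<open>log 2 N + log 2 (1 / \<delta>)\<close> zeros.
\<close>

lemma check_depth_cost:
  assumes x: "x \<in> ones n f" and \<epsilon>: "0 < \<epsilon>" and \<delta>: "0 < \<delta>" "\<delta> < 1"
  defines "L \<equiv> log 2 (card (ones n f)) + log 2 (1 / \<delta>)"
  shows "1 - \<delta> \<le> measure_pmf.prob (run n f (check_depth \<epsilon> x)) {r. real (snd r) \<le> 3 + 24 * L / \<epsilon>}"
proof -
  let ?A = "{r :: verdict \<times> nat. real (snd r) \<le> 3 + 24 * L / \<epsilon>}"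
  let ?z = "zeros x"
  let ?t = "nat \<lceil>12 * ?z / \<epsilon>\<rceil>"
  let ?k = "\<lambda>i. map_pmf (apsnd Suc)
      (run n f (if f (up_set x ! i) then edge_trials ?t else Output Reject))"
  have run: "run n f (check_depth \<epsilon> x) = bind_pmf (pmf_of_set {..<2 ^ ?z}) ?k"
    by (simp add: check_depth_def)
  have N: "card (ones n f) > 0"
    using x by (auto simp: card_gt_0_iff)
  have L: "L \<ge> 0"
    using \<delta> by (auto simp: L_def log_of_nat_nonneg intro!: add_nonneg_nonneg)
  show ?thesis
  \<comment> \<open>A shallow point makes every run cheap; a deep one is rejected after a single
    query with probability at least \<open>1 - \<delta>\<close>.\<close>
  proof (cases "?z \<le> L")
    case True
    have "12 * ?z / \<epsilon> \<le> 12 * L / \<epsilon>"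
      using True \<epsilon> by (intro divide_right_mono) auto
    moreover have "?t \<le> 12 * ?z / \<epsilon> + 1"
      using \<epsilon> by (simp add: of_nat_ceiling)
    \<comment> \<open>One query above \<open>x\<close>, then at most two calls per trial; rounding
      up \<open>?t\<close> costs the other 2.\<close>
    ultimately have t: "1 + 2 * ?t \<le> 3 + 24 * L / \<epsilon>"
      by simp
    have "measure_pmf.prob (run n f (check_depth \<epsilon> x)) ?A = 1"
    proof (subst measure_pmf.prob_eq_1)
      have "snd r \<le> 2 * ?t" if "r \<in> set_pmf (run n f (edge_trials ?t))" for r
        using that by (rule run_edge_trials_cost)
      moreover have "real (Suc m) \<le> 3 + 24 * L / \<epsilon>" if "m \<le> 2 * ?t" for m
        using t that by linarith
      ultimately show "AE r in measure_pmf (run n f (check_depth \<epsilon> x)). r \<in> ?A"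
        by (auto simp: run AE_measure_pmf_iff simp del: of_nat_Suc split: if_splits)
    qed simp
    then show ?thesis using \<delta> by simp
  next
    case False
    let ?I = "{i \<in> {..<2 ^ ?z}. f (up_set x ! i)}"
    \<comment> \<open>Distinctness of \<open>up_set x\<close> turns surviving indices into as many
      different ones of \<open>f\<close>.\<close>
    have "card ?I = card ((!) (up_set x) ` ?I)"
      by (rule card_image[symmetric]) (auto simp: inj_on_def nth_eq_iff_index_eq distinct_up_set)
    also have "(!) (up_set x) ` ?I \<subseteq> ones n f"
      using x up_set_above[of _ x] by (auto simp: ones_def cube_def)
    then have "card ((!) (up_set x) ` ?I) \<le> card (ones n f)"
      by (intro card_mono) auto
    finally have I: "card ?I \<le> card (ones n f)" .
    have "real (card (ones n f)) / \<delta> = 2 powr L"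
      using N \<delta> by (simp add: L_def powr_add log_divide powr_diff)
    also have "\<dots> \<le> 2 powr ?z" using False by simp
    finally have "card (ones n f) \<le> \<delta> * 2 ^ ?z"
      using \<delta> by (simp add: powr_realpow field_simps)
    with I have I': "card ?I / 2 ^ ?z \<le> \<delta>"
      by (simp add: field_simps)
    have "measure_pmf.prob (pmf_of_set {..<2 ^ ?z}) ?I = card ?I / 2 ^ ?z"
      by (subst measure_pmf_of_set) (auto simp: lessThan_empty_iff Int_def)
    then have "measure_pmf.prob (pmf_of_set {..<2 ^ ?z}) (- ?I) \<ge> 1 - \<delta>"
      using I' measure_pmf.prob_compl[of ?I "pmf_of_set {..<2 ^ ?z}"] by (simp add: Compl_eq_Diff_UNIV)
    also have "1 * measure_pmf.prob (pmf_of_set {..<2 ^ ?z}) (- ?I)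
        \<le> measure_pmf.prob (run n f (check_depth \<epsilon> x)) ?A"
      unfolding run
    proof (rule prob_bind_pmf_ge)
      fix i assume "i \<in> set_pmf (pmf_of_set {..<2 ^ ?z})" "i \<in> - ?I"
      then have "\<not> f (up_set x ! i)" by (simp add: lessThan_empty_iff)
      then show "1 \<le> measure_pmf.prob (?k i) ?A"
        using L \<epsilon> by (simp add: indicator_def)
    qed simp
    finally show ?thesis by simp
  qed
qed

lemma prob_Samp_ge:
  assumes "\<And>r. r \<in> set_pmf (samp n f) \<Longrightarrow> c \<le> measure_pmf.prob (run n f (k r)) {r. real (snd r) \<le> B}"
    and "0 \<le> c"
  shows "c \<le> measure_pmf.prob (run n f (Samp k)) {r. real (snd r) \<le> B + 1}"
proof -
  have "c * measure_pmf.prob (samp n f) UNIV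
      \<le> measure_pmf.prob (run n f (Samp k)) {r. real (snd r) \<le> B + 1}"
    unfolding run.simps by (rule prob_bind_pmf_ge) (use assms in \<open>auto simp: vimage_def add.commute\<close>)
  then show ?thesis by simp
qed

text \<open>The bound of \<open>check_depth_cost\<close> is uniform over all ones \<open>x\<close>,
  so it does not matter which sample is kept; each draw adds one call.\<close>

lemma explore_cost:
  assumes "x \<in> ones n f" "0 < \<epsilon>" "0 < \<delta>" "\<delta> < 1"
  shows "1 - \<delta> \<le> measure_pmf.prob (run n f (explore \<epsilon> s x))
    {r. real (snd r) \<le> 3 + 24 * (log 2 (card (ones n f)) + log 2 (1 / \<delta>)) / \<epsilon> + s}"
  using assms(1)
proof (induction s arbitrary: x)
  case 0
  with check_depth_cost[OF 0 assms(2-4)] show ?case by simp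
next
  case (Suc s)
  let ?B = "3 + 24 * (log 2 (card (ones n f)) + log 2 (1 / \<delta>)) / \<epsilon> + s"
  have "1 - \<delta> \<le> measure_pmf.prob (run n f (explore \<epsilon> (Suc s) x)) {r. real (snd r) \<le> ?B + 1}"
    unfolding explore.simps
    by (rule prob_Samp_ge) (use Suc assms in \<open>auto simp: set_pmf_samp split: if_splits\<close>)
  then show ?case by (simp add: algebra_simps)
qed

lemma monotonicity_tester_cost:
  assumes \<epsilon>: "0 < \<epsilon>" and \<delta>: "0 < \<delta>" "\<delta> < 1 / 2"
  shows "1 - \<delta> \<le> measure_pmf.prob (run n f (monotonicity_tester \<epsilon>))
    {r. real (snd r) \<le> 35 * (log 2 (1 / \<delta>) / \<epsilon> + log 2 (card (ones n f)) / \<epsilon>)}"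
proof -
  define N where "N = log 2 (card (ones n f))"
  define D where "D = log 2 (1 / \<delta>)"
  let ?A = "{r :: verdict \<times> nat. real (snd r) \<le> 35 * (D / \<epsilon> + N / \<epsilon>)}"
  have N: "N \<ge> 0" by (simp add: N_def log_of_nat_nonneg)
  \<comment> \<open>As \<delta> < 1/2, additive constants can be absorbed into
    \<open>D / \<epsilon>\<close>.\<close>
  have "log 2 2 \<le> D"
    unfolding D_def using \<delta> by (intro log_mono) (auto simp: field_simps)
  then have D: "D \<ge> 1" by simp
  have nonneg: "0 \<le> 35 * (D / \<epsilon> + N / \<epsilon>)"
    using N D \<epsilon> by simp
  have "1 - \<delta> \<le> measure_pmf.prob (run n f (monotonicity_tester \<epsilon>)) ?A"
  proof (cases "\<epsilon> > 1")
    case True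
    then show ?thesis using nonneg \<delta> by (simp add: monotonicity_tester_def indicator_def)
  next
    case False
    let ?s = "nat \<lceil>6 / \<epsilon>\<rceil>"
    define B where "B = 3 + 24 * (N + D) / \<epsilon> + ?s"
    have s: "?s \<le> 6 / \<epsilon> + 1"
      using \<epsilon> by (simp add: of_nat_ceiling)
    have one: "1 \<le> 1 / \<epsilon>" "1 / \<epsilon> \<le> D / \<epsilon>"
      using \<epsilon> D False by (auto intro: divide_right_mono)
    \<comment> \<open>With \<open>1 \<le> e \<le> d\<close> the left side is at most 24 m + 24 d + 6
      e + 5, hence at most 24 m + 35 d.\<close>
    have B: "B + 1 \<le> 35 * (D / \<epsilon> + N / \<epsilon>)"
    proof -
      define d m e k where "d = D / \<epsilon>" and "m = N / \<epsilon>" and "e = 1 / \<epsilon>" and "k = real ?s"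
      have "B = 3 + (24 * m + 24 * d) + k" "k \<le> 6 * e + 1" "1 \<le> e" "e \<le> d" "0 \<le> m"
        using s one N \<epsilon> by (simp_all add: add_divide_distrib B_def d_def m_def e_def k_def)
      then show ?thesis
        unfolding d_def[symmetric] m_def[symmetric] by (simp add: distrib_left)
    qed
    have B0: "0 \<le> B"
      unfolding B_def using N D \<epsilon> by (intro add_nonneg_nonneg divide_nonneg_pos of_nat_0_le_iff) auto
    have "1 - \<delta> \<le> measure_pmf.prob (run n f (case r of None \<Rightarrow> Output Accept | Some x \<Rightarrow> explore \<epsilon> ?s x))
        {r. real (snd r) \<le> B}" if "r \<in> set_pmf (samp n f)" for r
    proof (cases r)
      case None
      then show ?thesis using B0 \<delta> by (simp add: indicator_def)
    next
      case (Some x)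
      then have "x \<in> ones n f"
        using that by (auto simp: set_pmf_samp split: if_splits)
      then show ?thesis
        using Some explore_cost[of x n f \<epsilon> \<delta> ?s] \<epsilon> \<delta> by (simp add: B_def N_def D_def)
    qed
    then have "1 - \<delta> \<le> measure_pmf.prob (run n f (monotonicity_tester \<epsilon>)) {r. real (snd r) \<le> B + 1}"
      unfolding monotonicity_tester_def if_not_P[OF False] using \<delta> by (intro prob_Samp_ge) auto
    also have "\<dots> \<le> measure_pmf.prob (run n f (monotonicity_tester \<epsilon>)) ?A"
      using B by (intro measure_pmf.finite_measure_mono) auto
    finally show ?thesis .
  qed
  then show ?thesis by (simp add: N_def D_def)
qed

section \<open>Soundness\<close>

definition acceptance :: "nat \<Rightarrow> (point \<Rightarrow> bool) \<Rightarrow> algorithm \<Rightarrow> real" where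
  "acceptance n f T = measure_pmf.prob (run n f T) {r. fst r = Accept}"

lemma acceptance_Output [simp]: "acceptance n f (Output v) = of_bool (v = Accept)"
  by (simp add: acceptance_def indicator_def)

lemma acceptance_MQ [simp]: "acceptance n f (MQ x k) = acceptance n f (k (f x))"
  by (simp add: acceptance_def vimage_def)

lemma acceptance_Samp:
  "ones n f \<noteq> {} \<Longrightarrow>
    acceptance n f (Samp k) = (\<Sum>x\<in>ones n f. acceptance n f (k (Some x))) / card (ones n f)"
  by (simp add: acceptance_def samp_def bind_map_pmf prob_bind_pmf integral_pmf_of_set vimage_def)

lemma acceptance_Rand:
  "m > 0 \<Longrightarrow>
    acceptance n f (Rand (pmf_of_set {..<m}) k) = (\<Sum>i<m. acceptance n f (k i)) / m"
  by (simp add: acceptance_def prob_bind_pmf integral_pmf_of_set lessThan_empty_iff)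

lemma acceptance_nonneg: "0 \<le> acceptance n f T"
  by (simp add: acceptance_def)

lemma acceptance_le_1: "acceptance n f T \<le> 1"
  by (simp add: acceptance_def)

lemma prob_Reject: "measure_pmf.prob (run n f T) {r. fst r = Reject} = 1 - acceptance n f T"
proof -
  have "{r :: verdict \<times> nat. fst r = Reject} = UNIV - {r. fst r = Accept}"
    by (simp add: set_eq_iff) (metis verdict.exhaust verdict.distinct(1))
  then show ?thesis
    using measure_pmf.prob_compl[of "{r. fst r = Accept}" "run n f T"] by (simp add: acceptance_def)
qed

lemma violations_le_zeros: "violations f x \<le> zeros x"
  using length_filter_le[of "\<lambda>y. \<not> f y" "up_neighbours x"] by (simp add: violations_def)

lemma sum_up_neighbours_nth:
  "(\<Sum>i<zeros x. of_bool (f (up_neighbours x ! i))) = real (zeros x) - real (violations f x)"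
proof -
  have "(\<Sum>i<length ys. of_bool (f (ys ! i))) = real (length ys) - length (filter (\<lambda>y. \<not> f y) ys)"
    for ys :: "point list"
    by (induction ys rule: rev_induct) (auto simp: nth_append)
  from this[of "up_neighbours x"] show ?thesis by (simp add: violations_def)
qed

text \<open>Points without zeros contribute nothing to the sum, since \<open>0 / 0 = 0\<close>.\<close>

definition detection :: "nat \<Rightarrow> (point \<Rightarrow> bool) \<Rightarrow> real" where
  "detection n f = (\<Sum>x\<in>ones n f. violations f x / zeros x) / card (ones n f)"

lemma detection_le_1: "detection n f \<le> 1"
proof -
  have "(\<Sum>x\<in>ones n f. violations f x / zeros x) \<le> (\<Sum>x\<in>ones n f. 1)"
    using violations_le_zeros by (intro sum_mono) (auto simp: divide_le_eq_1)
  then show ?thesis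
    by (cases "ones n f = {}") (auto simp: detection_def divide_le_eq_1 card_gt_0_iff)
qed

text \<open>The trials are independent, and each rejects with probability exactly
  \<open>detection n f\<close>.\<close>

lemma acceptance_edge_trials:
  assumes "ones n f \<noteq> {}"
  shows "acceptance n f (edge_trials t) = (1 - detection n f) ^ t"
proof (induction t)
  case (Suc t)
  let ?a = "acceptance n f (edge_trials t)" and ?N = "real (card (ones n f))"
  have N: "?N > 0" using assms by (simp add: card_gt_0_iff)
  have "acceptance n f (edge_trials (Suc t)) =
      (\<Sum>x\<in>ones n f. (1 - violations f x / zeros x) * ?a) / ?N"
    unfolding edge_trials.simps acceptance_Samp[OF assms]
  proof (intro arg_cong2[where f = "(/)"] sum.cong)
    fix x
    show "acceptance n f (case Some x of None \<Rightarrow> Output Accept | Some x \<Rightarrow>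
        if zeros x = 0 then edge_trials t
        else Rand (pmf_of_set {..<zeros x}) (\<lambda>i. MQ (up_neighbours x ! i)
          (\<lambda>b. if b then edge_trials t else Output Reject)))
      = (1 - violations f x / zeros x) * ?a"
    proof (cases "zeros x = 0")
      case False
      have "(\<Sum>i<zeros x. acceptance n f (if f (up_neighbours x ! i) then edge_trials t else Output Reject))
          = (\<Sum>i<zeros x. of_bool (f (up_neighbours x ! i)) * ?a)"
        by (rule sum.cong) auto
      also have "\<dots> = (real (zeros x) - real (violations f x)) * ?a"
        by (simp only: sum_distrib_right[symmetric] sum_up_neighbours_nth)
      finally show ?thesis
        using False by (simp add: acceptance_Rand field_simps)
    qed simp
  qed simp_all
  also have "\<dots> = (1 - detection n f) * ?a"
    unfolding sum_distrib_right[symmetric] sum_subtractf detection_def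
    using N assms by (simp add: field_simps)
  finally show ?case using Suc by simp
qed simp

lemma acceptance_check_depth_le:
  "acceptance n f (check_depth \<epsilon> x) \<le> acceptance n f (edge_trials (nat \<lceil>12 * zeros x / \<epsilon>\<rceil>))"
proof -
  let ?a = "acceptance n f (edge_trials (nat \<lceil>12 * zeros x / \<epsilon>\<rceil>))"
  have "(\<Sum>i<2 ^ zeros x. acceptance n f (if f (up_set x ! i)
          then edge_trials (nat \<lceil>12 * zeros x / \<epsilon>\<rceil>) else Output Reject))
      \<le> (\<Sum>i<(2::nat) ^ zeros x. ?a)"
    by (rule sum_mono) (simp add: acceptance_nonneg)
  then show ?thesis
    by (simp add: check_depth_def acceptance_Rand field_simps)
qed

text \<open>From 1 - p \<le> exp(-p) and e \<ge> 2. Two failures of probability 1/8 stay below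
  1/3.\<close>

lemma power_one_minus_le:
  fixes p :: real
  assumes "p \<le> 1" "3 \<le> p * t"
  shows "(1 - p) ^ t \<le> 1 / 8"
proof -
  have "(1 - p) ^ t \<le> exp (- p) ^ t"
    using assms exp_ge_add_one_self[of "- p"] by (intro power_mono) auto
  also have "\<dots> = exp (- (p * t))"
    by (simp add: exp_of_nat_mult[symmetric] mult.commute)
  also have "\<dots> \<le> exp (- 3)" using assms by simp
  also have "exp (- 3 :: real) \<le> 1 / 8"
  proof -
    have "(2::real) ^ 3 \<le> exp 1 ^ 3"
      using exp_ge_add_one_self[of 1] by (intro power_mono) auto
    also have "\<dots> = exp (3::real)"
      by (simp add: exp_of_nat_mult[symmetric])
    finally show ?thesis by (simp add: exp_minus field_simps)
  qed
  finally show ?thesis .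
qed

text \<open>A union bound: either all \<open>s\<close> samples have fewer than \<open>q\<close>
  zeros, or the kept point reaches depth \<open>q\<close>, never becomes shallower, and is accepted
  with probability at most \<open>c\<close>.\<close>

lemma acceptance_explore_le:
  fixes p :: real
  assumes ne: "ones n f \<noteq> {}" and p: "p \<le> 1" "p * card (ones n f) \<le> card {y \<in> ones n f. q \<le> zeros y}"
    and c: "\<And>y. q \<le> zeros y \<Longrightarrow> acceptance n f (check_depth \<epsilon> y) \<le> c"
  shows "acceptance n f (explore \<epsilon> s x) \<le> (1 - p) ^ s + c"
proof -
  let ?N = "real (card (ones n f))"
  have N: "?N > 0" using ne by (simp add: card_gt_0_iff)
  have deep: "acceptance n f (explore \<epsilon> s x) \<le> c" if "q \<le> zeros x" for s x
    using that
  proof (induction s arbitrary: x)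
    case (Suc s)
    have "acceptance n f (explore \<epsilon> (Suc s) x) \<le> (\<Sum>y\<in>ones n f. c) / ?N"
      unfolding explore.simps acceptance_Samp[OF ne]
      using Suc by (intro divide_right_mono sum_mono) auto
    then show ?case using N ne by simp
  qed (simp add: c)
  \<comment> \<open>Some point of depth \<open>q\<close> is needed to see that \<open>c\<close>
    bounds a probability; it need not lie in the cube.\<close>
  have "zeros (replicate q False) = q"
    by (induction q) auto
  then have "c \<ge> 0"
    using order_trans[OF acceptance_nonneg c[of "replicate q False"]] by simp
  show "acceptance n f (explore \<epsilon> s x) \<le> (1 - p) ^ s + c"
  proof (induction s arbitrary: x)
    case 0
    then show ?case using acceptance_le_1[of n f] \<open>c \<ge> 0\<close> by (simp add: add_increasing2)
  next
    case (Suc s)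
    let ?D = "{y \<in> ones n f. q \<le> zeros y}"
    have "acceptance n f (explore \<epsilon> (Suc s) x)
        \<le> (\<Sum>y\<in>ones n f. of_bool (\<not> q \<le> zeros y) * (1 - p) ^ s + c) / ?N"
      unfolding explore.simps acceptance_Samp[OF ne]
    proof (intro divide_right_mono sum_mono)
      fix y
      show "acceptance n f (case Some y of None \<Rightarrow> Output Accept
          | Some y \<Rightarrow> explore \<epsilon> s (if zeros x < zeros y then y else x))
        \<le> of_bool (\<not> q \<le> zeros y) * (1 - p) ^ s + c"
        using Suc deep by (cases "q \<le> zeros y") auto
    qed simp
    also have "\<dots> = (card (ones n f - ?D) * (1 - p) ^ s) / ?N + c"
    proof -
      have "ones n f - ?D = {y \<in> ones n f. \<not> q \<le> zeros y}"
        by auto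
      then have "(\<Sum>y\<in>ones n f. of_bool (\<not> q \<le> zeros y)) = real (card (ones n f - ?D))"
        by (simp add: of_bool_def sum.If_cases Int_def)
      then show ?thesis
        using N ne by (simp add: sum.distrib sum_distrib_right[symmetric] add_divide_distrib)
    qed
    also have "real (card (ones n f - ?D)) = ?N - card ?D"
      by (subst card_Diff_subset) (auto intro!: of_nat_diff card_mono)
    also have "(?N - card ?D) * (1 - p) ^ s / ?N \<le> ((1 - p) * ?N) * (1 - p) ^ s / ?N"
      using p by (intro divide_right_mono mult_right_mono) (auto simp: algebra_simps)
    also have "\<dots> = (1 - p) ^ Suc s" using ne by simp
    finally show ?case by simp
  qed
qed

lemma monotonicity_tester_sound:
  assumes \<epsilon>: "0 < \<epsilon>" and far: "\<epsilon> \<le> rel_dist_class n f (monotone_functions n)"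
  shows "2 / 3 \<le> measure_pmf.prob (run n f (monotonicity_tester \<epsilon>)) {r. fst r = Reject}"
proof -
  let ?N = "real (card (ones n f))"
  have \<epsilon>1: "\<epsilon> \<le> 1" using far rel_dist_monotone_functions_le_1 by (rule order_trans)
  have ne: "ones n f \<noteq> {}"
  proof
    assume "ones n f = {}"
    then have "rel_dist n f (monotonize n f) = 0" by (simp add: rel_dist_def)
    moreover have "\<epsilon> \<le> rel_dist n f (monotonize n f)"
      using far rel_dist_class_le[OF monotonize_in_monotone_functions] by (rule order_trans)
    ultimately show False using \<epsilon> by simp
  qed
  then have N: "?N > 0" by (simp add: card_gt_0_iff)
  define few where "few q \<longleftrightarrow> card {x \<in> ones n f. zeros x > q} \<le> \<epsilon> * ?N / 2" for q
  have "zeros x \<le> n" if "x \<in> ones n f" for x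
    using that count_le_length[of x False] by (simp add: ones_def cube_def)
  then have empty: "{x \<in> ones n f. zeros x > n} = {}"
    by (auto simp: not_less)
  have "few n" unfolding few_def empty using \<epsilon> by simp
  define q where "q = (LEAST q. few q)"
  have "few q" unfolding q_def using \<open>few n\<close> by (rule LeastI)
  then have V: "\<epsilon> * ?N / 4 \<le> (\<Sum>x | x \<in> ones n f \<and> zeros x \<le> q. real (violations f x))"
    using truncated_violations_ge[OF far] by (simp add: few_def)
  have no_zeros: "violations f x = 0" if "zeros x = 0" for x
    using that violations_le_zeros[of f x] by simp
  \<comment> \<open>For \<open>q = 0\<close> only the all-ones point could survive the truncation,
    and no violated edge starts there.\<close>
  have "q \<noteq> 0"
  proof
    assume "q = 0"
    then have "(\<Sum>x | x \<in> ones n f \<and> zeros x \<le> q. real (violations f x)) = 0"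
      by (intro sum.neutral) (auto simp: no_zeros)
    then show False using V mult_pos_pos[OF \<epsilon> N] by linarith
  qed
  \<comment> \<open>Minimality of \<open>q\<close> makes more than an \<epsilon>/2 fraction of the
    ones have at least \<open>q\<close> zeros.\<close>
  then have "\<not> few (q - 1)" unfolding q_def by (intro not_less_Least) auto
  moreover have "{x \<in> ones n f. zeros x > q - 1} = {x \<in> ones n f. q \<le> zeros x}"
    using \<open>q \<noteq> 0\<close> by auto
  ultimately have deep: "\<epsilon> / 2 * ?N \<le> card {x \<in> ones n f. q \<le> zeros x}"
    by (simp add: few_def)
  \<comment> \<open>Points with at most \<open>q\<close> zeros have at most \<open>q\<close> upper
    neighbours, so each violated edge weighs at least \<open>1 / q\<close> in
    \<open>detection\<close>.\<close>
  have "\<epsilon> / (4 * q) = (\<epsilon> * ?N / 4) / q / ?N" using ne by simp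
  also have "\<dots> \<le> (\<Sum>x | x \<in> ones n f \<and> zeros x \<le> q. real (violations f x)) / q / ?N"
    using V by (intro divide_right_mono) auto
  also have "\<dots> \<le> (\<Sum>x | x \<in> ones n f \<and> zeros x \<le> q. violations f x / zeros x) / ?N"
    unfolding sum_divide_distrib[of _ _ "real q"]
  proof (intro divide_right_mono sum_mono)
    fix x assume x: "x \<in> {x. x \<in> ones n f \<and> zeros x \<le> q}"
    show "violations f x / q \<le> violations f x / zeros x"
    proof (cases "zeros x = 0")
      case True
      then show ?thesis by (simp add: no_zeros)
    qed (use x in \<open>auto intro: divide_left_mono\<close>)
  qed simp
  also have "\<dots> \<le> detection n f"
    unfolding detection_def by (intro divide_right_mono sum_mono2) auto
  finally have det: "\<epsilon> / (4 * q) \<le> detection n f" .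
  have trials: "acceptance n f (check_depth \<epsilon> y) \<le> 1 / 8" if "q \<le> zeros y" for y
  proof -
    let ?t = "nat \<lceil>12 * zeros y / \<epsilon>\<rceil>"
    have "12 * q / \<epsilon> \<le> 12 * zeros y / \<epsilon>"
      using that \<epsilon> by (intro divide_right_mono) auto
    also have "\<dots> \<le> ?t" by (rule real_nat_ceiling_ge)
    finally have "\<epsilon> / (4 * q) * (12 * q / \<epsilon>) \<le> detection n f * ?t"
      using det \<epsilon> by (intro mult_mono) (auto intro: order_trans[OF _ det])
    then have "3 \<le> detection n f * ?t" using \<epsilon> \<open>q \<noteq> 0\<close> by simp
    then have "acceptance n f (edge_trials ?t) \<le> 1 / 8"
      unfolding acceptance_edge_trials[OF ne] by (rule power_one_minus_le[OF detection_le_1])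
    then show ?thesis using acceptance_check_depth_le order_trans by blast
  qed
  let ?s = "nat \<lceil>6 / \<epsilon>\<rceil>"
  \<comment> \<open>The first phase also expects at least 3 successes, so it misses depth
    \<open>q\<close> with probability at most 1/8.\<close>
  have "\<epsilon> / 2 * (6 / \<epsilon>) \<le> \<epsilon> / 2 * ?s"
    using \<epsilon> by (intro mult_left_mono real_nat_ceiling_ge) auto
  then have "(1 - \<epsilon> / 2) ^ ?s \<le> 1 / 8"
    using \<epsilon> \<epsilon>1 by (intro power_one_minus_le) auto
  then have "acceptance n f (explore \<epsilon> ?s x) \<le> 1 / 8 + 1 / 8" for x
    using acceptance_explore_le[OF ne _ deep trials, of ?s x] \<epsilon>1 by simp
  then have "(\<Sum>x\<in>ones n f. acceptance n f (explore \<epsilon> ?s x)) / ?N \<le> (\<Sum>x\<in>ones n f. 1 / 8 + 1 / 8) / ?N"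
    by (intro divide_right_mono sum_mono) auto
  then have "acceptance n f (monotonicity_tester \<epsilon>) \<le> 1 / 4"
    using \<epsilon>1 N ne by (simp add: monotonicity_tester_def acceptance_Samp[OF ne])
  then show ?thesis by (simp add: prob_Reject)
qed

theorem theorem1p1:
  "\<exists>(A :: nat \<Rightarrow> real \<Rightarrow> real \<Rightarrow> algorithm) (C :: real). C > 0 \<and>
     (\<forall>(\<epsilon> :: real) (\<delta> :: real) (n :: nat). 0 < \<epsilon> \<and> 0 < \<delta> \<and> \<delta> < 1 / 2 \<longrightarrow>
        one_sided_rel_error_tester n \<epsilon> (monotone_functions n) (A n \<epsilon> \<delta>) \<and>
        (\<forall>f :: point \<Rightarrow> bool.
           measure_pmf.prob (run n f (A n \<epsilon> \<delta>))
             {r. real (snd r) \<le> C * (log 2 (1 / \<delta>) / \<epsilon> + log 2 (real (card (ones n f))) / \<epsilon>)}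
           \<ge> 1 - \<delta>))"
  using monotonicity_tester_one_sided monotonicity_tester_sound monotonicity_tester_cost
  by (intro exI[of _ "\<lambda>n \<epsilon> \<delta>. monotonicity_tester \<epsilon>"] exI[of _ 35])
     (auto simp: one_sided_rel_error_tester_def)

end
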